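(* Let $(S,\cdot)$ be a partial semigroup and let $(Q,\le,\cdot)$ be a quantale. Then $(Q^S,\le,\cdot)$, the set of all functions $S\to Q$ ordered pointwise and equipped with convolution as multiplication, is a quantale; if $Q$ is distributive, so is $Q^S$. Moreover, if $S$ and $Q$ are both commutative then $Q^S$ is commutative, and if $S$ is a partial monoid and $Q$ is unital then $Q^S$ is unital with unit $\mathbb{1}$.
   Context: A partial semigroup is a set $S$ with a partial binary operation $\cdot$ (formally a semigroup structure on $S\cup\{\bot\}$ with $\bot\notin S$ absorbing, $x\cdot\bot=\bot=\bot\cdot x$; "$x\cdot y$ undefined" means $x\cdot y=\bot$) that is associative; a partial monoid additionally has a unit $1\in S$; it is commutative if $x\cdot y=y\cdot x$ for all $x,y$. A quantale $(Q,\le,\cdot)$ is a complete lattice with an associative multiplication distributing over arbitrary suprema on both sides: $x\cdot\sum_i y_i=\sum_i x\cdot y_i$ and $(\sum_i x_i)\cdot y=\sum_i x_i\cdot y$. It is unital if the multiplication has a unit $1$, commutative if the multiplication is, and distributive if $x\sqcap\sum_i y_i=\sum_i(x\sqcap y_i)$ and $x+\prod_i y_i=\prod_i(x+y_i)$ hold, where $+$/$\sum$ are suprema and $\sqcap$/$\prod$ infima. On $Q^S$: $f\le g$ iff $f(x)\le g(x)$ for all $x\in S$; suprema and infima are pointwise, $(\sum_i f_i)(x)=\sum_i f_i(x)$; convolution is $(f\cdot g)(x)=\sum_{x=y\cdot z} f(y)\cdot g(z)$, the supremum over all pairs $y,z\in S$ with $y\cdot z$ defined and equal to $x$; the unit is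 $\mathbb{1}(x)=1$ if $x=1$ and $\mathbb{1}(x)=0$ otherwise, where $0$ is the least element of $Q$. *)

theory Defs
  imports "HOL-Algebra.Complete_Lattice"
begin

section \<open>Partial semigroups and partial monoids\<close>

text \<open>A partial operation is an \<open>option\<close>-valued one; \<^term>\<open>None\<close> plays the role of the
  undefined element \<open>\<bottom>\<close> adjoined to the carrier. The carrier may be empty.\<close>

record 'a partial_magma = "'a partial_object" +
  pmult :: "'a \<Rightarrow> 'a \<Rightarrow> 'a option"  (infixl \<open>\<bullet>\<index>\<close> 70)

definition carrier_bot :: "('a, 'm) partial_magma_scheme \<Rightarrow> 'a option set" where
  "carrier_bot S = insert None (Some ` carrier S)"

fun pmult_bot :: "('a, 'm) partial_magma_scheme \<Rightarrow> 'a option \<Rightarrow> 'a option \<Rightarrow> 'a option" where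
  "pmult_bot S (Some x) (Some y) = x \<bullet>\<^bsub>S\<^esub> y"
| "pmult_bot S None v = None"
| "pmult_bot S u None = None"

locale partial_semigroup =
  fixes S :: "('a, 'm) partial_magma_scheme" (structure)
  assumes pmult_closed:
      "\<lbrakk>x \<in> carrier S; y \<in> carrier S\<rbrakk> \<Longrightarrow> x \<bullet> y \<in> carrier_bot S"
    and pmult_assoc:
      "\<lbrakk>u \<in> carrier_bot S; v \<in> carrier_bot S; w \<in> carrier_bot S\<rbrakk>
        \<Longrightarrow> pmult_bot S (pmult_bot S u v) w = pmult_bot S u (pmult_bot S v w)"

locale comm_partial_semigroup = partial_semigroup +
  assumes pmult_comm: "\<lbrakk>x \<in> carrier S; y \<in> carrier S\<rbrakk> \<Longrightarrow> x \<bullet> y = y \<bullet> x"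

locale partial_monoid = partial_semigroup +
  fixes e :: 'a
  assumes unit_closed: "e \<in> carrier S"
    and unit_left: "x \<in> carrier S \<Longrightarrow> e \<bullet> x = Some x"
    and unit_right: "x \<in> carrier S \<Longrightarrow> x \<bullet> e = Some x"


section \<open>Quantales\<close>

record 'a quantale_struct = "'a gorder" +
  qmult :: "'a \<Rightarrow> 'a \<Rightarrow> 'a"  (infixl \<open>\<cdot>\<index>\<close> 75)

text \<open>A family \<open>(y\<^sub>i)\<^sub>i\<close> is represented by the (possibly empty) set of its members, on which its
  supremum and infimum depend.\<close>

locale quantale = complete_lattice Q
  for Q :: "('a, 'm) quantale_struct_scheme" (structure) +
  assumes qmult_closed: "\<lbrakk>x \<in> carrier Q; y \<in> carrier Q\<rbrakk> \<Longrightarrow> x \<cdot> y \<in> carrier Q"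
    and qmult_assoc:
      "\<lbrakk>x \<in> carrier Q; y \<in> carrier Q; z \<in> carrier Q\<rbrakk> \<Longrightarrow> (x \<cdot> y) \<cdot> z = x \<cdot> (y \<cdot> z)"
    and qmult_sup_distl:
      "\<lbrakk>x \<in> carrier Q; Y \<subseteq> carrier Q\<rbrakk> \<Longrightarrow> x \<cdot> (\<Squnion>Y) = \<Squnion>((\<lambda>y. x \<cdot> y) ` Y)"
    and qmult_sup_distr:
      "\<lbrakk>X \<subseteq> carrier Q; y \<in> carrier Q\<rbrakk> \<Longrightarrow> (\<Squnion>X) \<cdot> y = \<Squnion>((\<lambda>x. x \<cdot> y) ` X)"

locale distributive_quantale = quantale +
  assumes meet_sup_dist:
      "\<lbrakk>x \<in> carrier Q; Y \<subseteq> carrier Q\<rbrakk> \<Longrightarrow> x \<sqinter> (\<Squnion>Y) = \<Squnion>((\<lambda>y. x \<sqinter> y) ` Y)"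
    and join_inf_dist:
      "\<lbrakk>x \<in> carrier Q; Y \<subseteq> carrier Q\<rbrakk> \<Longrightarrow> x \<squnion> (\<Sqinter>Y) = \<Sqinter>((\<lambda>y. x \<squnion> y) ` Y)"

locale comm_quantale = quantale +
  assumes qmult_comm: "\<lbrakk>x \<in> carrier Q; y \<in> carrier Q\<rbrakk> \<Longrightarrow> x \<cdot> y = y \<cdot> x"

locale unital_quantale = quantale +
  fixes i :: 'a
  assumes qunit_closed: "i \<in> carrier Q"
    and qunit_left: "x \<in> carrier Q \<Longrightarrow> i \<cdot> x = x"
    and qunit_right: "x \<in> carrier Q \<Longrightarrow> x \<cdot> i = x"


section \<open>The function space with convolution\<close>

definition convolution ::
  "('s, 'm) partial_magma_scheme \<Rightarrow> ('q, 'n) quantale_struct_scheme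
    \<Rightarrow> ('s \<Rightarrow> 'q) \<Rightarrow> ('s \<Rightarrow> 'q) \<Rightarrow> ('s \<Rightarrow> 'q)" where
  "convolution S Q f g =
    (\<lambda>x\<in>carrier S. \<Squnion>\<^bsub>Q\<^esub> {f y \<cdot>\<^bsub>Q\<^esub> g z | y z.
        y \<in> carrier S \<and> z \<in> carrier S \<and> y \<bullet>\<^bsub>S\<^esub> z = Some x})"

text \<open>Functions on the carrier of \<open>S\<close> are represented by extensional functions, so that HOL
  equality is equality of functions on the carrier. Only the order is specified: suprema and
  infima are those of this order.\<close>

definition fun_quantale ::
  "('s, 'm) partial_magma_scheme \<Rightarrow> ('q, 'n) quantale_struct_scheme
    \<Rightarrow> ('s \<Rightarrow> 'q) quantale_struct" where
  "fun_quantale S Q =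
    \<lparr> carrier = carrier S \<rightarrow>\<^sub>E carrier Q,
      eq = (=),
      le = (\<lambda>f g. \<forall>x\<in>carrier S. f x \<sqsubseteq>\<^bsub>Q\<^esub> g x),
      qmult = convolution S Q \<rparr>"

definition unit_fun ::
  "('s, 'm) partial_magma_scheme \<Rightarrow> ('q, 'n) quantale_struct_scheme
    \<Rightarrow> 's \<Rightarrow> 'q \<Rightarrow> ('s \<Rightarrow> 'q)" where
  "unit_fun S Q e i = (\<lambda>x\<in>carrier S. if x = e then i else \<bottom>\<^bsub>Q\<^esub>)"

end

theory Submission
  imports Defs
begin

text \<open>In a complete lattice an element is determined by its upper bounds, and distributivity
  turns every bound on a product of suprema into a bound on the products of the members. Hence
  \<open>(f \<cdot> g) \<cdot> h\<close> and \<open>f \<cdot> (g \<cdot> h)\<close> have, at each point \<open>x\<close>, the common bounds of all products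
  \<open>f a \<cdot> g b \<cdot> h c\<close> with \<open>a b c = x\<close>. The other multiplicative laws reduce in the same way to
  a comparison of bounds, and the purely order-theoretic laws hold pointwise.\<close>

section \<open>Suprema, infima and equality in terms of bounds\<close>

context complete_lattice
begin

lemma sup_le_iff:
  assumes "A \<subseteq> carrier L" "u \<in> carrier L"
  shows "\<Squnion>A \<sqsubseteq> u \<longleftrightarrow> (\<forall>a\<in>A. a \<sqsubseteq> u)"
  using assms by (meson le_trans subsetD sup_closed sup_least sup_upper)

lemma le_inf_iff:
  assumes "A \<subseteq> carrier L" "u \<in> carrier L"
  shows "u \<sqsubseteq> \<Sqinter>A \<longleftrightarrow> (\<forall>a\<in>A. u \<sqsubseteq> a)"
  using assms by (meson le_trans subsetD inf_closed inf_greatest inf_lower)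

text \<open>Taking \<open>u\<close> to be \<open>a\<close> and then \<open>b\<close> gives both
  inequalities, and antisymmetry concludes.\<close>

lemma eq_by_upper_bounds:
  assumes "a \<in> carrier L" "b \<in> carrier L" "\<And>u. u \<in> carrier L \<Longrightarrow> a \<sqsubseteq> u \<longleftrightarrow> b \<sqsubseteq> u"
  shows "a = b"
  using assms by blast

lemma eq_by_lower_bounds:
  assumes "a \<in> carrier L" "b \<in> carrier L" "\<And>u. u \<in> carrier L \<Longrightarrow> u \<sqsubseteq> a \<longleftrightarrow> u \<sqsubseteq> b"
  shows "a = b"
  using assms by blast

text \<open>Serves to compute suprema in the function space, where only the order is given: a
  candidate with the right upper bounds must be the supremum.\<close>

lemma sup_equality:
  assumes "A \<subseteq> carrier L" "s \<in> carrier L" "\<And>u. u \<in> carrier L \<Longrightarrow> s \<sqsubseteq> u \<longleftrightarrow> (\<forall>a\<in>A. a \<sqsubseteq> u)"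
  shows "\<Squnion>A = s"
  using assms by (intro eq_by_upper_bounds) (auto simp: sup_le_iff)

lemma inf_equality:
  assumes "A \<subseteq> carrier L" "s \<in> carrier L" "\<And>u. u \<in> carrier L \<Longrightarrow> u \<sqsubseteq> s \<longleftrightarrow> (\<forall>a\<in>A. u \<sqsubseteq> a)"
  shows "\<Sqinter>A = s"
  using assms by (intro eq_by_lower_bounds) (auto simp: le_inf_iff)

lemma sup_empty: "\<Squnion>{} = \<bottom>"
  using weak_sup_empty by (simp add: eq_is_equal)

end

section \<open>Bounds on products of suprema\<close>

context quantale
begin

lemma sup_qmult_le_iff:
  assumes "A \<subseteq> carrier Q" "b \<in> carrier Q" "u \<in> carrier Q"
  shows "\<Squnion>A \<cdot> b \<sqsubseteq> u \<longleftrightarrow> (\<forall>a\<in>A. a \<cdot> b \<sqsubseteq> u)"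
proof -
  have "(\<lambda>a. a \<cdot> b) ` A \<subseteq> carrier Q"
    using assms by (auto intro: qmult_closed)
  then show ?thesis
    using assms by (simp add: qmult_sup_distr sup_le_iff)
qed

lemma qmult_sup_le_iff:
  assumes "a \<in> carrier Q" "B \<subseteq> carrier Q" "u \<in> carrier Q"
  shows "a \<cdot> \<Squnion>B \<sqsubseteq> u \<longleftrightarrow> (\<forall>b\<in>B. a \<cdot> b \<sqsubseteq> u)"
proof -
  have "(\<lambda>b. a \<cdot> b) ` B \<subseteq> carrier Q"
    using assms by (auto intro: qmult_closed)
  then show ?thesis
    using assms by (simp add: qmult_sup_distl sup_le_iff)
qed

text \<open>The least element is the supremum of the empty family, so annihilation is the empty case
  of distributivity.\<close>

lemma bottom_qmult: "a \<in> carrier Q \<Longrightarrow> \<bottom> \<cdot> a = \<bottom>"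
  using qmult_sup_distr[of "{}" a] by (simp add: sup_empty)

lemma qmult_bottom: "a \<in> carrier Q \<Longrightarrow> a \<cdot> \<bottom> = \<bottom>"
  using qmult_sup_distl[of a "{}"] by (simp add: sup_empty)

end

section \<open>Factorisations in a partial semigroup\<close>

lemma (in partial_semigroup) pmult_mem:
  "\<lbrakk>x \<bullet> y = Some z; x \<in> carrier S; y \<in> carrier S\<rbrakk> \<Longrightarrow> z \<in> carrier S"
  using pmult_closed[of x y] by (auto simp: carrier_bot_def)

text \<open>Each side says that one bracketing of \<open>a b c\<close> is defined with value
  \<open>x\<close>. The associative law with \<open>None\<close> adjoined makes the bracketings
  agree, so undefinedness of one excludes the other. Closure puts the intermediate products into the
  carrier.\<close>

lemma (in partial_semigroup) pmult_assoc_Some: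
  assumes "a \<in> carrier S" "b \<in> carrier S" "c \<in> carrier S"
  shows "(\<exists>y\<in>carrier S. a \<bullet> b = Some y \<and> y \<bullet> c = Some x)
    \<longleftrightarrow> (\<exists>z\<in>carrier S. b \<bullet> c = Some z \<and> a \<bullet> z = Some x)"
proof -
  have "pmult_bot S (a \<bullet> b) (Some c) = pmult_bot S (Some a) (b \<bullet> c)"
    using pmult_assoc[of "Some a" "Some b" "Some c"] assms by (simp add: carrier_bot_def)
  then show ?thesis
    using assms by (cases "a \<bullet> b"; cases "b \<bullet> c") (auto dest: pmult_mem)
qed

section \<open>The complete lattice of functions under the pointwise order\<close>

locale quantale_convolution = S: partial_semigroup S + quantale Q
  for S :: "('s, 'm) partial_magma_scheme" and Q :: "('q, 'n) quantale_struct_scheme" (structure)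
begin

abbreviation "F \<equiv> fun_quantale S Q"

lemma carrier_F: "carrier F = carrier S \<rightarrow>\<^sub>E carrier Q"
  and le_F: "f \<sqsubseteq>\<^bsub>F\<^esub> g \<longleftrightarrow> (\<forall>x\<in>carrier S. f x \<sqsubseteq> g x)"
  and qmult_F: "f \<cdot>\<^bsub>F\<^esub> g = convolution S Q f g"
  by (simp_all add: fun_quantale_def)

lemma F_mem: "f \<in> carrier F \<Longrightarrow> x \<in> carrier S \<Longrightarrow> f x \<in> carrier Q"
  by (auto simp: carrier_F)

text \<open>Members of \<open>carrier F\<close> are extensional, so they agree outside
  \<open>carrier S\<close> in any case.\<close>

lemma F_eqI:
  assumes "f \<in> carrier F" "g \<in> carrier F" "\<And>x. x \<in> carrier S \<Longrightarrow> f x = g x"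
  shows "f = g"
  using assms unfolding carrier_F by (rule PiE_ext)

lemma partial_order_F: "partial_order F"
proof
  have "x = y" if "x \<sqsubseteq>\<^bsub>F\<^esub> y" "y \<sqsubseteq>\<^bsub>F\<^esub> x" "x \<in> carrier F" "y \<in> carrier F" for x y
    using that by (intro F_eqI[of x y] le_antisym) (auto simp: le_F F_mem)
  then show "x .=\<^bsub>F\<^esub> y" if "x \<sqsubseteq>\<^bsub>F\<^esub> y" "y \<sqsubseteq>\<^bsub>F\<^esub> x" "x \<in> carrier F" "y \<in> carrier F" for x y
    using that by (simp add: fun_quantale_def)
  show "x \<sqsubseteq>\<^bsub>F\<^esub> z" if "x \<sqsubseteq>\<^bsub>F\<^esub> y" "y \<sqsubseteq>\<^bsub>F\<^esub> z" "x \<in> carrier F" "y \<in> carrier F" "z \<in> carrier F" for x y z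
    unfolding le_F
  proof
    fix s assume "s \<in> carrier S"
    with that show "x s \<sqsubseteq> z s"
      by (intro le_trans[of "x s" "y s" "z s"]) (auto simp: le_F F_mem)
  qed
qed (auto simp: le_F F_mem, (simp_all add: fun_quantale_def))

lemma image_F:
  assumes "A \<subseteq> carrier F" "x \<in> carrier S"
  shows "(\<lambda>f. f x) ` A \<subseteq> carrier Q"
  using assms by (auto intro: F_mem)

lemma pointwise_sup_mem:
  "A \<subseteq> carrier F \<Longrightarrow> (\<lambda>x\<in>carrier S. \<Squnion>((\<lambda>f. f x) ` A)) \<in> carrier F"
  by (simp add: carrier_F image_F[unfolded carrier_F])

lemma pointwise_inf_mem:
  "A \<subseteq> carrier F \<Longrightarrow> (\<lambda>x\<in>carrier S. \<Sqinter>((\<lambda>f. f x) ` A)) \<in> carrier F"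
  by (simp add: carrier_F image_F[unfolded carrier_F])

text \<open>Both sides amount to \<open>f x \<sqsubseteq> u x\<close> for all \<open>f\<close> in
  \<open>A\<close> and all \<open>x\<close>. The fact precedes the completeness of \<open>F\<close>:
  it yields existence of suprema first and their pointwise formula afterwards.\<close>

lemma pointwise_sup_le_iff:
  assumes "A \<subseteq> carrier F" "u \<in> carrier F"
  shows "(\<lambda>x\<in>carrier S. \<Squnion>((\<lambda>f. f x) ` A)) \<sqsubseteq>\<^bsub>F\<^esub> u \<longleftrightarrow> (\<forall>f\<in>A. f \<sqsubseteq>\<^bsub>F\<^esub> u)"
  using assms by (auto simp: le_F sup_le_iff image_F F_mem)

lemma le_pointwise_inf_iff:
  assumes "A \<subseteq> carrier F" "u \<in> carrier F"
  shows "u \<sqsubseteq>\<^bsub>F\<^esub> (\<lambda>x\<in>carrier S. \<Sqinter>((\<lambda>f. f x) ` A)) \<longleftrightarrow> (\<forall>f\<in>A. u \<sqsubseteq>\<^bsub>F\<^esub> f)"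
  using assms by (auto simp: le_F le_inf_iff image_F F_mem)

lemma complete_lattice_F: "complete_lattice F"
proof -
  interpret F: partial_order F
    by (rule partial_order_F)
  show ?thesis
  proof
    fix A assume A: "A \<subseteq> carrier F"
    let ?s = "\<lambda>x\<in>carrier S. \<Squnion>((\<lambda>f. f x) ` A)" and ?i = "\<lambda>x\<in>carrier S. \<Sqinter>((\<lambda>f. f x) ` A)"
    have "least F ?s (Upper F A)"
    proof (rule least_UpperI)
      show s: "?s \<in> carrier F"
        by (rule pointwise_sup_mem[OF A])
      \<comment> \<open>Reflexivity makes \<open>?s\<close> a bound of itself, hence a bound of
        every member of \<open>A\<close>.\<close>
      show "f \<sqsubseteq>\<^bsub>F\<^esub> ?s" if "f \<in> A" for f
        using F.le_refl[OF s] that unfolding pointwise_sup_le_iff[OF A s] by blast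
      show "?s \<sqsubseteq>\<^bsub>F\<^esub> u" if "u \<in> Upper F A" for u
        using that A by (subst pointwise_sup_le_iff[OF A]) (auto simp: Upper_def)
    qed (rule A)
    then show "\<exists>s. least F s (Upper F A)"
      by blast
    have "greatest F ?i (Lower F A)"
    proof (rule greatest_LowerI)
      show i: "?i \<in> carrier F"
        by (rule pointwise_inf_mem[OF A])
      show "?i \<sqsubseteq>\<^bsub>F\<^esub> f" if "f \<in> A" for f
        using F.le_refl[OF i] that unfolding le_pointwise_inf_iff[OF A i] by blast
      show "l \<sqsubseteq>\<^bsub>F\<^esub> ?i" if "l \<in> Lower F A" for l
        using that A by (subst le_pointwise_inf_iff[OF A]) (auto simp: Lower_def)
    qed (rule A)
    then show "\<exists>i. greatest F i (Lower F A)"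
      by blast
  qed
qed

sublocale F: complete_lattice F
  by (rule complete_lattice_F)

text \<open>The supremum in \<open>F\<close> is defined by choice from the order; it has the same
  upper bounds as the pointwise function and therefore equals it.\<close>

lemma sup_F: "A \<subseteq> carrier F \<Longrightarrow> \<Squnion>\<^bsub>F\<^esub>A = (\<lambda>x\<in>carrier S. \<Squnion>((\<lambda>f. f x) ` A))"
  by (intro F.sup_equality) (simp_all add: pointwise_sup_mem pointwise_sup_le_iff)

lemma inf_F: "A \<subseteq> carrier F \<Longrightarrow> \<Sqinter>\<^bsub>F\<^esub>A = (\<lambda>x\<in>carrier S. \<Sqinter>((\<lambda>f. f x) ` A))"
  by (intro F.inf_equality) (simp_all add: pointwise_inf_mem le_pointwise_inf_iff)

lemma join_F:
  assumes "f \<in> carrier F" "g \<in> carrier F" "x \<in> carrier S"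
  shows "(f \<squnion>\<^bsub>F\<^esub> g) x = f x \<squnion> g x"
  using assms by (simp add: join_def sup_F)

lemma meet_F:
  assumes "f \<in> carrier F" "g \<in> carrier F" "x \<in> carrier S"
  shows "(f \<sqinter>\<^bsub>F\<^esub> g) x = f x \<sqinter> g x"
  using assms by (simp add: meet_def inf_F)

section \<open>Convolution and its upper bounds\<close>

lemma convolution_terms_closed:
  assumes "f \<in> carrier F" "g \<in> carrier F"
  shows "{f y \<cdot> g z | y z. y \<in> carrier S \<and> z \<in> carrier S \<and> y \<bullet>\<^bsub>S\<^esub> z = Some x} \<subseteq> carrier Q"
  using assms by (auto simp: qmult_closed F_mem)

lemma convolution_closed:
  assumes "f \<in> carrier F" "g \<in> carrier F"
  shows "f \<cdot>\<^bsub>F\<^esub> g \<in> carrier F"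
  using convolution_terms_closed[OF assms] by (simp add: qmult_F convolution_def carrier_F)

text \<open>The value at \<open>x\<close> is a supremum over the factorisations of \<open>x\<close>,
  so a bound can be tested on each of them; with no factorisation the value is the least element.
  Apart from closure, the later laws use convolution only through this fact and its two variants
  with an extra factor.\<close>

lemma convolution_le_iff:
  assumes "f \<in> carrier F" "g \<in> carrier F" "x \<in> carrier S" "u \<in> carrier Q"
  shows "(f \<cdot>\<^bsub>F\<^esub> g) x \<sqsubseteq> u \<longleftrightarrow>
    (\<forall>y\<in>carrier S. \<forall>z\<in>carrier S. y \<bullet>\<^bsub>S\<^esub> z = Some x \<longrightarrow> f y \<cdot> g z \<sqsubseteq> u)"
  using convolution_terms_closed[OF assms(1,2)] assms(3,4)
  by (simp add: qmult_F convolution_def sup_le_iff) blast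

text \<open>Distributivity carries \<open>q\<close> inside the supremum. This handles a convolution
  that is itself a factor, as in the associative law.\<close>

lemma convolution_qmult_le_iff:
  assumes "f \<in> carrier F" "g \<in> carrier F" "x \<in> carrier S" "q \<in> carrier Q" "u \<in> carrier Q"
  shows "(f \<cdot>\<^bsub>F\<^esub> g) x \<cdot> q \<sqsubseteq> u \<longleftrightarrow>
    (\<forall>y\<in>carrier S. \<forall>z\<in>carrier S. y \<bullet>\<^bsub>S\<^esub> z = Some x \<longrightarrow> f y \<cdot> g z \<cdot> q \<sqsubseteq> u)"
  using convolution_terms_closed[OF assms(1,2)] assms(3-)
  by (simp add: qmult_F convolution_def sup_qmult_le_iff) blast

lemma qmult_convolution_le_iff:
  assumes "f \<in> carrier F" "g \<in> carrier F" "x \<in> carrier S" "q \<in> carrier Q" "u \<in> carrier Q"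
  shows "q \<cdot> (f \<cdot>\<^bsub>F\<^esub> g) x \<sqsubseteq> u \<longleftrightarrow>
    (\<forall>y\<in>carrier S. \<forall>z\<in>carrier S. y \<bullet>\<^bsub>S\<^esub> z = Some x \<longrightarrow> q \<cdot> (f y \<cdot> g z) \<sqsubseteq> u)"
  using convolution_terms_closed[OF assms(1,2)] assms(3-)
  by (simp add: qmult_F convolution_def qmult_sup_le_iff) blast

text \<open>The bounds \<open>u\<close> are elements of \<open>Q\<close> at a single point, not
  functions, which is the form in which bounds on convolutions are available.\<close>

lemma F_eq_by_upper_bounds:
  assumes "f \<in> carrier F" "g \<in> carrier F"
    and "\<And>x u. x \<in> carrier S \<Longrightarrow> u \<in> carrier Q \<Longrightarrow> f x \<sqsubseteq> u \<longleftrightarrow> g x \<sqsubseteq> u"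
  shows "f = g"
  using assms by (intro F_eqI eq_by_upper_bounds) (auto intro: F_mem)

section \<open>The quantale laws for convolution\<close>

lemma convolution_assoc:
  assumes "f \<in> carrier F" "g \<in> carrier F" "h \<in> carrier F"
  shows "(f \<cdot>\<^bsub>F\<^esub> g) \<cdot>\<^bsub>F\<^esub> h = f \<cdot>\<^bsub>F\<^esub> (g \<cdot>\<^bsub>F\<^esub> h)"
proof (rule F_eq_by_upper_bounds)
  fix x u assume x: "x \<in> carrier S" and u: "u \<in> carrier Q"
  \<comment> \<open>Unfold the outer convolution over \<open>y c = x\<close>, then the inner one
    over \<open>a b = y\<close>. The product does not mention \<open>y\<close>, so its universal
    quantifier becomes an existential one in the premise.\<close>
  have "((f \<cdot>\<^bsub>F\<^esub> g) \<cdot>\<^bsub>F\<^esub> h) x \<sqsubseteq> u \<longleftrightarrow>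
      (\<forall>a\<in>carrier S. \<forall>b\<in>carrier S. \<forall>c\<in>carrier S.
        (\<exists>y\<in>carrier S. a \<bullet>\<^bsub>S\<^esub> b = Some y \<and> y \<bullet>\<^bsub>S\<^esub> c = Some x) \<longrightarrow> f a \<cdot> g b \<cdot> h c \<sqsubseteq> u)"
    using assms x u
    by (simp add: convolution_le_iff convolution_qmult_le_iff convolution_closed F_mem) blast
  \<comment> \<open>Both associative laws act here: that of \<open>S\<close> rebrackets the
    constraint on the triple, that of \<open>Q\<close> rebrackets the product.\<close>
  also have "\<dots> \<longleftrightarrow>
      (\<forall>a\<in>carrier S. \<forall>b\<in>carrier S. \<forall>c\<in>carrier S.
        (\<exists>z\<in>carrier S. b \<bullet>\<^bsub>S\<^esub> c = Some z \<and> a \<bullet>\<^bsub>S\<^esub> z = Some x) \<longrightarrow> f a \<cdot> (g b \<cdot> h c) \<sqsubseteq> u)"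
    using assms by (simp add: S.pmult_assoc_Some qmult_assoc F_mem)
  also have "\<dots> \<longleftrightarrow> (f \<cdot>\<^bsub>F\<^esub> (g \<cdot>\<^bsub>F\<^esub> h)) x \<sqsubseteq> u"
    using assms x u
    by (simp add: convolution_le_iff qmult_convolution_le_iff convolution_closed F_mem) blast
  finally show "((f \<cdot>\<^bsub>F\<^esub> g) \<cdot>\<^bsub>F\<^esub> h) x \<sqsubseteq> u \<longleftrightarrow> (f \<cdot>\<^bsub>F\<^esub> (g \<cdot>\<^bsub>F\<^esub> h)) x \<sqsubseteq> u" .
qed (use assms in \<open>simp_all add: convolution_closed\<close>)

text \<open>At each \<open>x\<close> both sides have the common bounds of all
  \<open>f y \<cdot> g z\<close> with \<open>g\<close> in \<open>G\<close> and
  \<open>y z = x\<close>; they differ only in the order of quantifiers. An empty \<open>G\<close>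
  needs no separate treatment.\<close>

lemma convolution_sup_distl:
  assumes f: "f \<in> carrier F" and G: "G \<subseteq> carrier F"
  shows "f \<cdot>\<^bsub>F\<^esub> \<Squnion>\<^bsub>F\<^esub>G = \<Squnion>\<^bsub>F\<^esub>((\<lambda>g. f \<cdot>\<^bsub>F\<^esub> g) ` G)"
proof (rule F_eq_by_upper_bounds)
  have G': "(\<lambda>g. f \<cdot>\<^bsub>F\<^esub> g) ` G \<subseteq> carrier F"
    using f G by (auto intro: convolution_closed)
  then show "\<Squnion>\<^bsub>F\<^esub>((\<lambda>g. f \<cdot>\<^bsub>F\<^esub> g) ` G) \<in> carrier F"
    by simp
  show "f \<cdot>\<^bsub>F\<^esub> \<Squnion>\<^bsub>F\<^esub>G \<in> carrier F"
    using f G by (simp add: convolution_closed)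
  fix x u assume x: "x \<in> carrier S" and u: "u \<in> carrier Q"
  have "(f \<cdot>\<^bsub>F\<^esub> \<Squnion>\<^bsub>F\<^esub>G) x \<sqsubseteq> u \<longleftrightarrow>
      (\<forall>y\<in>carrier S. \<forall>z\<in>carrier S. y \<bullet>\<^bsub>S\<^esub> z = Some x \<longrightarrow> f y \<cdot> (\<Squnion>\<^bsub>F\<^esub>G) z \<sqsubseteq> u)"
    using f G x u by (intro convolution_le_iff) simp_all
  \<comment> \<open>The supremum of \<open>G\<close> is taken pointwise, so distributivity in
    \<open>Q\<close> reduces the bound to the single members of \<open>G\<close>.\<close>
  also have "\<dots> \<longleftrightarrow>
      (\<forall>g\<in>G. \<forall>y\<in>carrier S. \<forall>z\<in>carrier S. y \<bullet>\<^bsub>S\<^esub> z = Some x \<longrightarrow> f y \<cdot> g z \<sqsubseteq> u)"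
    using f G u by (simp add: sup_F qmult_sup_le_iff image_F F_mem) blast
  also have "\<dots> \<longleftrightarrow> (\<forall>g\<in>G. (f \<cdot>\<^bsub>F\<^esub> g) x \<sqsubseteq> u)"
    using f G x u by (intro ball_cong refl convolution_le_iff[symmetric]) auto
  also have "\<dots> \<longleftrightarrow> (\<Squnion>\<^bsub>F\<^esub>((\<lambda>g. f \<cdot>\<^bsub>F\<^esub> g) ` G)) x \<sqsubseteq> u"
    using x u image_F[OF G' x] by (simp add: sup_F[OF G'] sup_le_iff)
  finally show "(f \<cdot>\<^bsub>F\<^esub> \<Squnion>\<^bsub>F\<^esub>G) x \<sqsubseteq> u \<longleftrightarrow> (\<Squnion>\<^bsub>F\<^esub>((\<lambda>g. f \<cdot>\<^bsub>F\<^esub> g) ` G)) x \<sqsubseteq> u" .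
qed

text \<open>Neither multiplication is assumed commutative, so the argument is repeated with the
  supremum in the first factor.\<close>

lemma convolution_sup_distr:
  assumes G: "G \<subseteq> carrier F" and f: "f \<in> carrier F"
  shows "\<Squnion>\<^bsub>F\<^esub>G \<cdot>\<^bsub>F\<^esub> f = \<Squnion>\<^bsub>F\<^esub>((\<lambda>g. g \<cdot>\<^bsub>F\<^esub> f) ` G)"
proof (rule F_eq_by_upper_bounds)
  have G': "(\<lambda>g. g \<cdot>\<^bsub>F\<^esub> f) ` G \<subseteq> carrier F"
    using f G by (auto intro: convolution_closed)
  then show "\<Squnion>\<^bsub>F\<^esub>((\<lambda>g. g \<cdot>\<^bsub>F\<^esub> f) ` G) \<in> carrier F"
    by simp
  show "\<Squnion>\<^bsub>F\<^esub>G \<cdot>\<^bsub>F\<^esub> f \<in> carrier F"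
    using f G by (simp add: convolution_closed)
  fix x u assume x: "x \<in> carrier S" and u: "u \<in> carrier Q"
  have "(\<Squnion>\<^bsub>F\<^esub>G \<cdot>\<^bsub>F\<^esub> f) x \<sqsubseteq> u \<longleftrightarrow>
      (\<forall>y\<in>carrier S. \<forall>z\<in>carrier S. y \<bullet>\<^bsub>S\<^esub> z = Some x \<longrightarrow> (\<Squnion>\<^bsub>F\<^esub>G) y \<cdot> f z \<sqsubseteq> u)"
    using f G x u by (intro convolution_le_iff) simp_all
  also have "\<dots> \<longleftrightarrow>
      (\<forall>g\<in>G. \<forall>y\<in>carrier S. \<forall>z\<in>carrier S. y \<bullet>\<^bsub>S\<^esub> z = Some x \<longrightarrow> g y \<cdot> f z \<sqsubseteq> u)"
    using f G u by (simp add: sup_F sup_qmult_le_iff image_F F_mem) blast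
  also have "\<dots> \<longleftrightarrow> (\<forall>g\<in>G. (g \<cdot>\<^bsub>F\<^esub> f) x \<sqsubseteq> u)"
    using f G x u by (intro ball_cong refl convolution_le_iff[symmetric]) auto
  also have "\<dots> \<longleftrightarrow> (\<Squnion>\<^bsub>F\<^esub>((\<lambda>g. g \<cdot>\<^bsub>F\<^esub> f) ` G)) x \<sqsubseteq> u"
    using x u image_F[OF G' x] by (simp add: sup_F[OF G'] sup_le_iff)
  finally show "(\<Squnion>\<^bsub>F\<^esub>G \<cdot>\<^bsub>F\<^esub> f) x \<sqsubseteq> u \<longleftrightarrow> (\<Squnion>\<^bsub>F\<^esub>((\<lambda>g. g \<cdot>\<^bsub>F\<^esub> f) ` G)) x \<sqsubseteq> u" .
qed

section \<open>The quantale of functions and its further properties\<close>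

lemma quantale_F: "quantale F"
  by unfold_locales
    (simp_all add: convolution_closed convolution_assoc convolution_sup_distl convolution_sup_distr)

text \<open>Meets, joins, suprema and infima of functions are all pointwise, so each law at
  \<open>x\<close> is the law of \<open>Q\<close> for \<open>f x\<close> and the values
  \<open>g x\<close> with \<open>g\<close> in \<open>G\<close>.\<close>

lemma distributive_quantale_F:
  assumes "distributive_quantale Q"
  shows "distributive_quantale F"
proof -
  interpret D: distributive_quantale Q
    by (rule assms)
  interpret F: quantale F
    by (rule quantale_F)
  show ?thesis
  proof
    fix f G assume f: "f \<in> carrier F" and G: "G \<subseteq> carrier F"
    have Gf: "g \<in> carrier F" if "g \<in> G" for g
      using G that by blast
    have G1: "(\<lambda>g. f \<sqinter>\<^bsub>F\<^esub> g) ` G \<subseteq> carrier F" and G2: "(\<lambda>g. f \<squnion>\<^bsub>F\<^esub> g) ` G \<subseteq> carrier F"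
      using f Gf by auto
    show "f \<sqinter>\<^bsub>F\<^esub> \<Squnion>\<^bsub>F\<^esub>G = \<Squnion>\<^bsub>F\<^esub>((\<lambda>g. f \<sqinter>\<^bsub>F\<^esub> g) ` G)"
    proof (rule F_eqI)
      fix x assume x: "x \<in> carrier S"
      have "(f \<sqinter>\<^bsub>F\<^esub> \<Squnion>\<^bsub>F\<^esub>G) x = f x \<sqinter> \<Squnion>((\<lambda>g. g x) ` G)"
        using x by (simp add: meet_F[OF f F.sup_closed[OF G]]) (simp add: sup_F[OF G])
      also have "\<dots> = \<Squnion>((\<lambda>g. f x \<sqinter> g x) ` G)"
        using f x image_F[OF G x] by (simp add: D.meet_sup_dist F_mem image_image)
      also have "\<dots> = (\<Squnion>\<^bsub>F\<^esub>((\<lambda>g. f \<sqinter>\<^bsub>F\<^esub> g) ` G)) x"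
        using f x by (simp add: sup_F[OF G1] image_image meet_F Gf cong: image_cong_simp)
      finally show "(f \<sqinter>\<^bsub>F\<^esub> \<Squnion>\<^bsub>F\<^esub>G) x = (\<Squnion>\<^bsub>F\<^esub>((\<lambda>g. f \<sqinter>\<^bsub>F\<^esub> g) ` G)) x" .
    qed (use f G G1 in simp_all)
    show "f \<squnion>\<^bsub>F\<^esub> \<Sqinter>\<^bsub>F\<^esub>G = \<Sqinter>\<^bsub>F\<^esub>((\<lambda>g. f \<squnion>\<^bsub>F\<^esub> g) ` G)"
    proof (rule F_eqI)
      fix x assume x: "x \<in> carrier S"
      have "(f \<squnion>\<^bsub>F\<^esub> \<Sqinter>\<^bsub>F\<^esub>G) x = f x \<squnion> \<Sqinter>((\<lambda>g. g x) ` G)"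
        using x by (simp add: join_F[OF f F.inf_closed[OF G]]) (simp add: inf_F[OF G])
      also have "\<dots> = \<Sqinter>((\<lambda>g. f x \<squnion> g x) ` G)"
        using f x image_F[OF G x] by (simp add: D.join_inf_dist F_mem image_image)
      also have "\<dots> = (\<Sqinter>\<^bsub>F\<^esub>((\<lambda>g. f \<squnion>\<^bsub>F\<^esub> g) ` G)) x"
        using f x by (simp add: inf_F[OF G2] image_image join_F Gf cong: image_cong_simp)
      finally show "(f \<squnion>\<^bsub>F\<^esub> \<Sqinter>\<^bsub>F\<^esub>G) x = (\<Sqinter>\<^bsub>F\<^esub>((\<lambda>g. f \<squnion>\<^bsub>F\<^esub> g) ` G)) x" .
    qed (use f G G2 in simp_all)
  qed
qed

text \<open>Commutativity of \<open>S\<close> lets \<open>y\<close> and \<open>z\<close> be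
  exchanged in every factorisation of \<open>x\<close>, and commutativity of \<open>Q\<close> makes
  the corresponding products equal; the two convolutions then have the same bounds.\<close>

lemma comm_quantale_F:
  assumes "comm_partial_semigroup S" "comm_quantale Q"
  shows "comm_quantale F"
proof -
  interpret CS: comm_partial_semigroup S
    by (rule assms)
  interpret CQ: comm_quantale Q
    by (rule assms)
  interpret F: quantale F
    by (rule quantale_F)
  show ?thesis
  proof
    fix f g assume fg: "f \<in> carrier F" "g \<in> carrier F"
    show "f \<cdot>\<^bsub>F\<^esub> g = g \<cdot>\<^bsub>F\<^esub> f"
    proof (rule F_eq_by_upper_bounds)
      fix x u assume "x \<in> carrier S" "u \<in> carrier Q"
      with fg show "(f \<cdot>\<^bsub>F\<^esub> g) x \<sqsubseteq> u \<longleftrightarrow> (g \<cdot>\<^bsub>F\<^esub> f) x \<sqsubseteq> u"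
        by (simp add: convolution_le_iff) (metis CS.pmult_comm CQ.qmult_comm F_mem)
    qed (use fg in \<open>simp_all add: convolution_closed\<close>)
  qed
qed

text \<open>Away from \<open>e\<close> the unit function is the least element, which annihilates
  products and so imposes no bound. Only factorisations of \<open>x\<close> through \<open>e\<close>
  remain, and these have \<open>x\<close> as the other factor.\<close>

lemma unital_quantale_F:
  assumes "partial_monoid S e" "unital_quantale Q i"
  shows "unital_quantale F (unit_fun S Q e i)"
proof -
  interpret MS: partial_monoid S e
    by (rule assms)
  interpret UQ: unital_quantale Q i
    by (rule assms)
  interpret F: quantale F
    by (rule quantale_F)
  let ?\<delta> = "unit_fun S Q e i"
  have unit_app: "?\<delta> x = (if x = e then i else \<bottom>)" if "x \<in> carrier S" for x
    using that by (simp add: unit_fun_def)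
  show ?thesis
  proof
    show \<delta>: "?\<delta> \<in> carrier F"
      by (auto simp: unit_fun_def carrier_F UQ.qunit_closed)
    fix f assume f: "f \<in> carrier F"
    show "?\<delta> \<cdot>\<^bsub>F\<^esub> f = f"
    proof (rule F_eq_by_upper_bounds)
      fix x u assume x: "x \<in> carrier S" and u: "u \<in> carrier Q"
      \<comment> \<open>For \<open>y = e\<close> the factor \<open>i\<close> disappears; otherwise
        the product is \<bottom>, which lies below every \<open>u\<close>.\<close>
      have "?\<delta> y \<cdot> f z \<sqsubseteq> u \<longleftrightarrow> (y = e \<longrightarrow> f z \<sqsubseteq> u)" if "y \<in> carrier S" "z \<in> carrier S" for y z
        using that f u by (simp add: unit_app F_mem UQ.qunit_left bottom_qmult)
      \<comment> \<open>The pair of \<open>e\<close> and \<open>x\<close> is a factorisation of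
        \<open>x\<close>, and a factorisation with first member \<open>e\<close> has second member
        \<open>x\<close>, by injectivity of \<open>Some\<close>.\<close>
      then show "(?\<delta> \<cdot>\<^bsub>F\<^esub> f) x \<sqsubseteq> u \<longleftrightarrow> f x \<sqsubseteq> u"
        using \<delta> f x u by (simp add: convolution_le_iff) (metis MS.unit_closed MS.unit_left option.inject)
    qed (use \<delta> f in \<open>simp_all add: convolution_closed\<close>)
    show "f \<cdot>\<^bsub>F\<^esub> ?\<delta> = f"
    proof (rule F_eq_by_upper_bounds)
      fix x u assume x: "x \<in> carrier S" and u: "u \<in> carrier Q"
      have "f y \<cdot> ?\<delta> z \<sqsubseteq> u \<longleftrightarrow> (z = e \<longrightarrow> f y \<sqsubseteq> u)" if "y \<in> carrier S" "z \<in> carrier S" for y z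
        using that f u by (simp add: unit_app F_mem UQ.qunit_right qmult_bottom)
      then show "(f \<cdot>\<^bsub>F\<^esub> ?\<delta>) x \<sqsubseteq> u \<longleftrightarrow> f x \<sqsubseteq> u"
        using \<delta> f x u by (simp add: convolution_le_iff) (metis MS.unit_closed MS.unit_right option.inject)
    qed (use \<delta> f in \<open>simp_all add: convolution_closed\<close>)
  qed
qed

end

theorem theorem3p3:
  fixes S :: "('s, 'm) partial_magma_scheme" and Q :: "('q, 'n) quantale_struct_scheme"
  assumes "partial_semigroup S" and "quantale Q"
  shows "quantale (fun_quantale S Q)
    \<and> (distributive_quantale Q \<longrightarrow> distributive_quantale (fun_quantale S Q))
    \<and> (comm_partial_semigroup S \<and> comm_quantale Q \<longrightarrow> comm_quantale (fun_quantale S Q))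
    \<and> (\<forall>e i. partial_monoid S e \<and> unital_quantale Q i
          \<longrightarrow> unital_quantale (fun_quantale S Q) (unit_fun S Q e i))"
proof -
  interpret quantale_convolution S Q
    using assms by (rule quantale_convolution.intro)
  show ?thesis
    using quantale_F distributive_quantale_F comm_quantale_F unital_quantale_F by blast
qed

end
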